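(* Let $(T_t)_{t\ge 0}$ be a sublinear Markov semigroup on a convex cone $\mathcal{H}$ of functions $f:\mathbb{R}^d\to\mathbb{R}$, with strong infinitesimal generator $(A,\mathcal{D}(A))$. If $f\in\mathcal{D}(A)$, then $$-\int_0^t T_s(-Af)\,ds\;\le\; T_tf-f\;\le\;\int_0^t T_s(Af)\,ds\qquad\text{for all } t\ge 0.$$
   Context: A family $\mathcal{H}$ of real-valued functions $f:\mathbb{R}^d\to\mathbb{R}$ is called a convex cone if $\alpha f+\beta g\in\mathcal{H}$ for all $\alpha,\beta\in\mathbb{R}$, $f,g\in\mathcal{H}$, and $c\mathbf{1}_{\mathbb{R}^d}\in\mathcal{H}$ for all $c\in\mathbb{R}$. A family of operators $T_t:\mathcal{H}\to\mathcal{H}$, $t\ge0$, is a sublinear Markov semigroup on $\mathcal{H}$ if each $T_t$ is sublinear ($T_t(f+g)\le T_tf+T_tg$ and $T_t(\lambda f)=\lambda T_tf$ for all $f,g\in\mathcal{H}$, $\lambda\in[0,\infty)$) and: (1) $T_{t+s}=T_tT_s$ for all $s,t\ge0$, and $T_0=\mathrm{id}$; (2) $f,g\in\mathcal{H}$, $f\le g$ implies $T_tf\le T_tg$ for all $t\ge0$; (3) $T_t(\mathbf{1}_{\mathbb{R}^d})\le \mathbf{1}_{\mathbb{R}^d}$. The strong infinitesimal generator $(A,\mathcal{D}(A))$ is defined by: $f\in\mathcal{D}(A)$ iff $f\in\mathcal{H}$ and there is $g\in\mathcal{H}$ with $\lim_{t\to0}\|t^{-1}(T_tf-f)-g\|_\infty=0$,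 where $\|\cdot\|_\infty$ is the sup-norm; then $Af:=g=\lim_{t\downarrow 0}t^{-1}(T_tf-f)$. The inequalities and the integrals in $s$ are understood pointwise, for each fixed $x\in\mathbb{R}^d$. *)

theory Defs
  imports "HOL-Analysis.Analysis"
begin

(* The scalars range over all reals, so a convex cone in this sense is a vector
   space of functions containing the constants; measurability, continuity or
   boundedness of its members is not required. *)
definition function_cone :: "(real ^ 'n \<Rightarrow> real) set \<Rightarrow> bool" where
  "function_cone H \<longleftrightarrow>
     (\<forall>f\<in>H. \<forall>g\<in>H. \<forall>\<alpha> \<beta>. (\<lambda>x. \<alpha> * f x + \<beta> * g x) \<in> H) \<and>
     (\<forall>c. (\<lambda>x. c) \<in> H)"

definition sublinear_on ::
  "(real ^ 'n \<Rightarrow> real) set \<Rightarrow> ((real ^ 'n \<Rightarrow> real) \<Rightarrow> (real ^ 'n \<Rightarrow> real)) \<Rightarrow> bool" where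
  "sublinear_on H S \<longleftrightarrow>
     (\<forall>f\<in>H. \<forall>g\<in>H. S (\<lambda>x. f x + g x) \<le> (\<lambda>x. S f x + S g x)) \<and>
     (\<forall>f\<in>H. \<forall>c\<ge>0. S (\<lambda>x. c * f x) = (\<lambda>x. c * S f x))"

(* The values of \<open>T t\<close> for \<open>t < 0\<close>, and of \<open>T t\<close> outside \<open>H\<close>, are unconstrained. *)
locale sublinear_Markov_semigroup =
  fixes H :: "(real ^ 'n \<Rightarrow> real) set"
    and T :: "real \<Rightarrow> (real ^ 'n \<Rightarrow> real) \<Rightarrow> (real ^ 'n \<Rightarrow> real)"
  assumes cone: "function_cone H"
    and maps_to: "\<And>t. t \<ge> 0 \<Longrightarrow> T t \<in> H \<rightarrow> H"
    and sublinear: "\<And>t. t \<ge> 0 \<Longrightarrow> sublinear_on H (T t)"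
    and semigroup: "\<And>s t f. s \<ge> 0 \<Longrightarrow> t \<ge> 0 \<Longrightarrow> f \<in> H \<Longrightarrow> T (t + s) f = T t (T s f)"
    and zero: "\<And>f. f \<in> H \<Longrightarrow> T 0 f = f"
    and monotone: "\<And>t f g. t \<ge> 0 \<Longrightarrow> f \<in> H \<Longrightarrow> g \<in> H \<Longrightarrow> f \<le> g \<Longrightarrow> T t f \<le> T t g"
    and sub_Markov: "\<And>t. t \<ge> 0 \<Longrightarrow> T t (\<lambda>x. 1) \<le> (\<lambda>x. 1)"

(* Extended-valued, so that the sup-norm of an unbounded function is \<open>\<infinity>\<close>. *)
definition sup_norm :: "(real ^ 'n \<Rightarrow> real) \<Rightarrow> ennreal" where
  "sup_norm u = (SUP x. ennreal \<bar>u x\<bar>)"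

definition has_strong_generator ::
  "(real ^ 'n \<Rightarrow> real) set \<Rightarrow> (real \<Rightarrow> (real ^ 'n \<Rightarrow> real) \<Rightarrow> (real ^ 'n \<Rightarrow> real)) \<Rightarrow>
   (real ^ 'n \<Rightarrow> real) \<Rightarrow> (real ^ 'n \<Rightarrow> real) \<Rightarrow> bool" where
  "has_strong_generator H T f g \<longleftrightarrow>
     f \<in> H \<and> g \<in> H \<and>
     ((\<lambda>t. sup_norm (\<lambda>x. (T t f x - f x) / t - g x)) \<longlongrightarrow> 0) (at_right 0)"

definition generator_domain ::
  "(real ^ 'n \<Rightarrow> real) set \<Rightarrow> (real \<Rightarrow> (real ^ 'n \<Rightarrow> real) \<Rightarrow> (real ^ 'n \<Rightarrow> real)) \<Rightarrow>
   (real ^ 'n \<Rightarrow> real) set" where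
  "generator_domain H T = {f. \<exists>g. has_strong_generator H T f g}"

definition generator ::
  "(real ^ 'n \<Rightarrow> real) set \<Rightarrow> (real \<Rightarrow> (real ^ 'n \<Rightarrow> real) \<Rightarrow> (real ^ 'n \<Rightarrow> real)) \<Rightarrow>
   (real ^ 'n \<Rightarrow> real) \<Rightarrow> (real ^ 'n \<Rightarrow> real)" where
  "generator H T f = (THE g. has_strong_generator H T f g)"

lemma has_strong_generator_pointwise:
  assumes "has_strong_generator H T f g"
  shows "((\<lambda>t. (T t f x - f x) / t) \<longlongrightarrow> g x) (at_right 0)"
proof -
  let ?u = "\<lambda>t. (T t f x - f x) / t - g x"
  have lim: "((\<lambda>t. sup_norm (\<lambda>x. (T t f x - f x) / t - g x)) \<longlongrightarrow> 0) (at_right 0)"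
    using assms by (simp add: has_strong_generator_def)
  have "((\<lambda>t. ennreal \<bar>?u t\<bar>) \<longlongrightarrow> ennreal 0) (at_right 0)"
    unfolding ennreal_0
  proof (rule tendsto_sandwich[OF _ _ tendsto_const lim])
    show "\<forall>\<^sub>F t in at_right 0. ennreal \<bar>?u t\<bar> \<le> sup_norm (\<lambda>x. (T t f x - f x) / t - g x)"
      unfolding sup_norm_def by (intro always_eventually allI SUP_upper) simp
  qed simp
  then have "((\<lambda>t. \<bar>?u t\<bar>) \<longlongrightarrow> 0) (at_right 0)"
    by (subst (asm) tendsto_ennreal_iff) auto
  then show ?thesis
    by (simp add: tendsto_rabs_zero_iff Lim_null[symmetric])
qed

(* The description in \<open>generator\<close> therefore denotes the limit. *)
lemma generator_eq:
  assumes "has_strong_generator H T f g"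
  shows "generator H T f = g"
  unfolding generator_def
proof (rule the_equality[where P = "has_strong_generator H T f", OF assms])
  fix g' assume g': "has_strong_generator H T f g'"
  show "g' = g"
  proof
    fix x
    show "g' x = g x"
      by (rule tendsto_unique[OF _ has_strong_generator_pointwise[OF g']
            has_strong_generator_pointwise[OF assms]]) simp
  qed
qed

end

theory Submission
  imports Defs
begin

text \<open>
  Write \<open>g = A f\<close>. Combining \<open>T\<^sub>s f - f = s g + o(s)\<close> (uniformly in space) with
  \<open>T\<^sub>s\<^sub>+\<^sub>h f - T\<^sub>s f \<le> T\<^sub>s (T\<^sub>h f - f)\<close> gives \<open>g \<le> T\<^sub>s g + \<epsilon>\<close> for all small \<open>s\<close>, whence
  \<open>T\<^sub>r g \<le> T\<^bsub>r+s\<^esub> g + \<epsilon>\<close> for all \<open>r \<ge> 0\<close>. So \<open>s \<mapsto> T\<^sub>s g x\<close> cannot drop by more than \<open>\<epsilon>\<close> over a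
  short time step. This one-sided uniform continuity makes it bounded on compact intervals, and
  Borel because its strict superlevel sets are unions of nondegenerate intervals; it also lets
  the local estimates \<open>T\<^sub>s\<^sub>+\<^sub>h f - T\<^sub>s f \<le> h (T\<^sub>s g + \<epsilon>)\<close> be summed up to the integral. The lower
  bound is the same argument for \<open>-g\<close> and \<open>f - T\<^sub>h f\<close>.
\<close>

section \<open>Functions with uniformly small drops\<close>

text \<open>Each component of \<open>S\<close> contains a right neighbourhood of any of its points,
  so it has nonempty interior. Disjoint sets of this kind are countably many, and every component is
  an interval, hence Borel.\<close>

lemma union_of_nondegenerate_intervals_borel:
  fixes S :: "real set"
  assumes "\<And>r. r \<in> S \<Longrightarrow> \<exists>\<eta>>0. {r..<r + \<eta>} \<subseteq> S"
  shows "S \<in> sets borel"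
proof -
  have "countable (components S)"
  proof (rule countable_disjoint_nonempty_interior_subsets)
    show "pairwise disjnt (components S)"
      using pairwise_disjoint_components[of S] by (simp add: pairwise_def disjnt_def)
    fix C assume C: "C \<in> components S" and "interior C = {}"
    show "C = {}"
    proof (rule ccontr)
      assume "C \<noteq> {}"
      then obtain r where r: "r \<in> C" by blast
      then obtain \<eta> where \<eta>: "\<eta> > 0" "{r..<r + \<eta>} \<subseteq> S"
        using assms[of r] in_components_subset[OF C] by auto
      have "{r..<r + \<eta>} \<subseteq> C"
        using r \<eta> by (intro components_maximal[OF C]) auto
      then have "{r<..<r + \<eta>} \<subseteq> interior C"
        by (intro interior_maximal) auto
      with \<open>interior C = {}\<close> \<open>\<eta> > 0\<close> show False by auto
    qed
  qed
  moreover have "C \<in> sets borel" if "C \<in> components S" for C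
    using in_components_connected[OF that]
    by (simp add: real_interval_borel_measurable is_interval_connected_1)
  ultimately have "\<Union> (components S) \<in> sets borel"
    by (intro sets.countable_Union) auto
  then show ?thesis by simp
qed

text \<open>One \<open>\<delta>\<close> serves every starting point \<open>r\<close>, so that short
  steps can be chained; upward jumps stay unrestricted.\<close>

definition small_drops :: "(real \<Rightarrow> real) \<Rightarrow> bool" where
  "small_drops \<psi> \<longleftrightarrow>
     (\<forall>\<epsilon>>0. \<exists>\<delta>>0. \<forall>r\<ge>0. \<forall>s\<ge>0. s < \<delta> \<longrightarrow> \<psi> r \<le> \<psi> (r + s) + \<epsilon>)"

text \<open>If \<open>a < \<psi> r\<close>, a drop of at most half the gap
  \<open>\<psi> r - a\<close> leaves \<open>\<psi>\<close> above \<open>a\<close> on a right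
  neighbourhood of \<open>r\<close>. The indicator cuts off negative times, where
  \<open>\<psi>\<close> is arbitrary.\<close>

lemma small_drops_measurable:
  assumes "small_drops \<psi>"
  shows "(\<lambda>s. indicator {0..} s *\<^sub>R \<psi> s) \<in> borel_measurable borel"
proof -
  have "{s \<in> {0..}. a < \<psi> s} \<in> sets borel" for a
  proof (rule union_of_nondegenerate_intervals_borel)
    fix r assume r: "r \<in> {s \<in> {0..}. a < \<psi> s}"
    then have "(\<psi> r - a) / 2 > 0" by simp
    then obtain \<delta> where \<delta>: "\<delta> > 0"
      "\<And>r' s. r' \<ge> 0 \<Longrightarrow> s \<ge> 0 \<Longrightarrow> s < \<delta> \<Longrightarrow> \<psi> r' \<le> \<psi> (r' + s) + (\<psi> r - a) / 2"
      using assms unfolding small_drops_def by meson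
    have "{r..<r + \<delta>} \<subseteq> {s \<in> {0..}. a < \<psi> s}"
    proof
      fix s assume s: "s \<in> {r..<r + \<delta>}"
      then have "\<psi> r \<le> \<psi> s + (\<psi> r - a) / 2" using r \<delta>(2)[of r "s - r"] by simp
      moreover have "a < \<psi> r" using r by simp
      ultimately have "a < \<psi> s" by argo
      with r s show "s \<in> {s \<in> {0..}. a < \<psi> s}" by simp
    qed
    with \<delta> show "\<exists>\<eta>>0. {r..<r + \<eta>} \<subseteq> {s \<in> {0..}. a < \<psi> s}" by blast
  qed
  then have "\<psi> \<in> borel_measurable (restrict_space borel {0..})"
    unfolding borel_measurable_iff_greater
    by (auto simp: sets_restrict_space_iff space_restrict_space)
  then show ?thesis
    by (subst (asm) borel_measurable_restrict_space_iff) auto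
qed

lemma small_drops_lower_bound:
  assumes "small_drops \<psi>" and "t \<ge> 0"
  obtains B where "\<And>r s. 0 \<le> r \<Longrightarrow> r \<le> s \<Longrightarrow> s \<le> t \<Longrightarrow> \<psi> r \<le> \<psi> s + B"
proof -
  obtain \<delta> where \<delta>: "\<delta> > 0"
    "\<And>r s. r \<ge> 0 \<Longrightarrow> s \<ge> 0 \<Longrightarrow> s < \<delta> \<Longrightarrow> \<psi> r \<le> \<psi> (r + s) + 1"
    using assms(1) unfolding small_drops_def by (meson zero_less_one)
  \<comment> \<open>Each substep costs at most 1. Its length is \<open>\<delta> / 2\<close> because
    \<open>\<delta>(2)\<close> demands a length strictly below \<open>\<delta>\<close>.\<close>
  have step: "\<psi> r \<le> \<psi> (r + s) + real n"
    if "r \<ge> 0" "s \<ge> 0" "s \<le> real n * (\<delta> / 2)" for n r s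
    using that
  proof (induction n arbitrary: s)
    case 0
    then show ?case by simp
  next
    case (Suc n)
    show ?case
    proof (cases "s \<le> \<delta> / 2")
      case True
      with \<delta>(1) have "s < \<delta>" by linarith
      then show ?thesis using \<delta>(2)[of r s] Suc.prems by simp
    next
      case False
      have "\<psi> r \<le> \<psi> (r + (s - \<delta> / 2)) + real n"
        using False Suc.prems by (intro Suc.IH) (auto simp: algebra_simps)
      also have "\<psi> (r + (s - \<delta> / 2)) \<le> \<psi> (r + (s - \<delta> / 2) + \<delta> / 2) + 1"
        using False Suc.prems \<delta>(1) by (intro \<delta>(2)) auto
      finally show ?thesis by simp
    qed
  qed
  obtain n where n: "t < real n * (\<delta> / 2)"
    using reals_Archimedean3[of "\<delta> / 2"] \<delta>(1) by auto
  show thesis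
  proof (rule that[of "real n"])
    fix r s :: real assume "0 \<le> r" "r \<le> s" "s \<le> t"
    then show "\<psi> r \<le> \<psi> s + real n"
      using step[of r "s - r" n] n by simp
  qed
qed

lemma small_drops_set_integrable:
  assumes "small_drops \<psi>"
  shows "set_integrable lborel {0..t} \<psi>"
proof (cases "t \<ge> 0")
  case True
  obtain B where B: "\<And>r s. 0 \<le> r \<Longrightarrow> r \<le> s \<Longrightarrow> s \<le> t \<Longrightarrow> \<psi> r \<le> \<psi> s + B"
    using small_drops_lower_bound[OF assms True] by blast
  \<comment> \<open>The total drop is controlled from 0 to \<open>s\<close> and from
    \<open>s\<close> to \<open>t\<close>: the first bounds \<open>\<psi> s\<close> from below, the
    second from above.\<close>
  have bound: "norm (\<psi> s) \<le> \<bar>\<psi> 0\<bar> + \<bar>\<psi> t\<bar> + \<bar>B\<bar>" if "s \<in> {0..t}" for s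
    using B[of 0 s] B[of s t] that by auto
  have "integrable lborel
      (\<lambda>s. indicator {0..t} s *\<^sub>R (indicator {0..} s *\<^sub>R \<psi> s))"
    using small_drops_measurable[OF assms] bound
    by (intro integrableI_bounded_set_indicator[where B = "\<bar>\<psi> 0\<bar> + \<bar>\<psi> t\<bar> + \<bar>B\<bar>"])
       (auto simp: indicator_def True)
  then show ?thesis
    unfolding set_integrable_def
    by (rule Bochner_Integration.integrable_cong[THEN iffD1, rotated -1])
       (auto simp: indicator_def)
qed simp

section \<open>Summing local increment bounds to an integral\<close>

lemma bound_from_local_bounds:
  fixes \<Phi> :: "real \<Rightarrow> real"
  assumes "\<delta> > 0" and "t \<ge> 0"
    and local: "\<And>s h. s \<ge> 0 \<Longrightarrow> 0 < h \<Longrightarrow> h < \<delta> \<Longrightarrow> \<Phi> (s + h) \<le> \<Phi> s + c * h"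
  shows "\<Phi> t \<le> \<Phi> 0 + c * t"
proof (cases "t = 0")
  case False
  obtain n where n: "t < real n * \<delta>"
    using reals_Archimedean3[OF \<open>\<delta> > 0\<close>] by auto
  then have "n > 0" using assms(2) by (cases n) auto
  define h where "h = t / real n"
  have h: "0 < h" "h < \<delta>"
    using n \<open>n > 0\<close> False assms(2) by (auto simp: h_def field_simps)
  have "\<Phi> (real k * h) \<le> \<Phi> 0 + c * (real k * h)" for k
  proof (induction k)
    case (Suc k)
    have "\<Phi> (real k * h + h) \<le> \<Phi> (real k * h) + c * h"
      using h by (intro local) auto
    with Suc show ?case by (simp add: algebra_simps)
  qed simp
  from this[of n] show ?thesis using \<open>n > 0\<close> by (simp add: h_def)
qed simp

text \<open>Over a short step from \<open>s\<close>, the integral of \<open>\<psi>\<close> is at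
  least \<open>h * (\<psi> s - \<eta>)\<close> while \<open>\<phi>\<close> grows by at most
  \<open>h * (\<psi> s + \<eta>)\<close>. Hence \<open>\<phi>\<close> minus the indefinite integral
  grows at rate at most \<open>2 * \<eta>\<close>.\<close>

lemma increment_le_set_integral:
  fixes \<phi> \<psi> :: "real \<Rightarrow> real"
  assumes \<psi>: "small_drops \<psi>" and "t \<ge> 0"
    and \<phi>: "\<And>\<epsilon>. \<epsilon> > 0 \<Longrightarrow>
      \<exists>\<delta>>0. \<forall>s\<ge>0. \<forall>h>0. h < \<delta> \<longrightarrow> \<phi> (s + h) - \<phi> s \<le> h * (\<psi> s + \<epsilon>)"
  shows "\<phi> t - \<phi> 0 \<le> (LINT s:{0..t}|lborel. \<psi> s)"
proof -
  have int: "\<psi> integrable_on {0..a}" for a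
    using set_borel_integral_eq_integral(1)[OF small_drops_set_integrable[OF \<psi>]] .
  define \<Phi> where "\<Phi> s = \<phi> s - integral {0..s} \<psi>" for s
  have "\<Phi> t \<le> \<Phi> 0 + \<epsilon>" if "\<epsilon> > 0" for \<epsilon>
  proof -
    \<comment> \<open>The accumulated error \<open>2 * \<eta> * t\<close> must not exceed
      \<open>\<epsilon>\<close>; \<open>t + 1\<close> keeps the quotient meaningful at
      \<open>t = 0\<close>.\<close>
    define \<eta> where "\<eta> = \<epsilon> / (2 * (t + 1))"
    have \<eta>: "\<eta> > 0" using that \<open>t \<ge> 0\<close> by (simp add: \<eta>_def)
    obtain \<delta>\<^sub>1 where \<delta>\<^sub>1: "\<delta>\<^sub>1 > 0"
      "\<And>r s. r \<ge> 0 \<Longrightarrow> s \<ge> 0 \<Longrightarrow> s < \<delta>\<^sub>1 \<Longrightarrow> \<psi> r \<le> \<psi> (r + s) + \<eta>"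
      using \<psi> \<eta> unfolding small_drops_def by meson
    obtain \<delta>\<^sub>2 where \<delta>\<^sub>2: "\<delta>\<^sub>2 > 0"
      "\<And>s h. s \<ge> 0 \<Longrightarrow> h > 0 \<Longrightarrow> h < \<delta>\<^sub>2 \<Longrightarrow> \<phi> (s + h) - \<phi> s \<le> h * (\<psi> s + \<eta>)"
      using \<phi>[OF \<eta>] by meson
    have "\<Phi> t \<le> \<Phi> 0 + 2 * \<eta> * t"
    proof (rule bound_from_local_bounds)
      show "min \<delta>\<^sub>1 \<delta>\<^sub>2 > 0" using \<delta>\<^sub>1 \<delta>\<^sub>2 by simp
      show "t \<ge> 0" by fact
      fix s h :: real assume s: "s \<ge> 0" and h: "0 < h" "h < min \<delta>\<^sub>1 \<delta>\<^sub>2"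
      have int': "\<psi> integrable_on {s..s + h}"
        using int[of "s + h"] by (rule integrable_on_subinterval) (use s in auto)
      have "h * (\<psi> s - \<eta>) = integral {s..s + h} (\<lambda>_. \<psi> s - \<eta>)"
        using h by simp
      also have "\<dots> \<le> integral {s..s + h} \<psi>"
      proof (rule integral_le)
        fix r assume "r \<in> {s..s + h}"
        then show "\<psi> s - \<eta> \<le> \<psi> r" using \<delta>\<^sub>1(2)[of s "r - s"] s h by simp
      qed (use int' in auto)
      finally have "h * (\<psi> s - \<eta>) \<le> integral {s..s + h} \<psi>" .
      moreover have "integral {0..s} \<psi> + integral {s..s + h} \<psi> = integral {0..s + h} \<psi>"
        using s h int by (intro Henstock_Kurzweil_Integration.integral_combine) auto
      moreover have "\<phi> (s + h) - \<phi> s \<le> h * (\<psi> s + \<eta>)"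
        using \<delta>\<^sub>2 s h by simp
      ultimately show "\<Phi> (s + h) \<le> \<Phi> s + 2 * \<eta> * h"
        by (simp add: \<Phi>_def algebra_simps)
    qed
    also have "2 * \<eta> * t \<le> \<epsilon>"
      using that \<open>t \<ge> 0\<close> by (simp add: \<eta>_def field_simps)
    finally show ?thesis by simp
  qed
  then have "\<Phi> t \<le> \<Phi> 0" by (rule field_le_epsilon)
  then show ?thesis
    by (simp add: \<Phi>_def set_borel_integral_eq_integral(2)[OF small_drops_set_integrable[OF \<psi>]])
qed

section \<open>Sublinear Markov semigroups\<close>

context sublinear_Markov_semigroup
begin

lemma lincomb_mem: "u \<in> H \<Longrightarrow> v \<in> H \<Longrightarrow> (\<lambda>x. a * u x + b * v x) \<in> H"
  using cone unfolding function_cone_def by blast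

lemma const_mem: "(\<lambda>x. c) \<in> H"
  using cone unfolding function_cone_def by blast

lemma add_mem: "u \<in> H \<Longrightarrow> v \<in> H \<Longrightarrow> (\<lambda>x. u x + v x) \<in> H"
  using lincomb_mem[of u v 1 1] by simp

lemma scale_mem: "u \<in> H \<Longrightarrow> (\<lambda>x. c * u x) \<in> H"
  using lincomb_mem[of u u c 0] by simp

lemma T_mem: "t \<ge> 0 \<Longrightarrow> u \<in> H \<Longrightarrow> T t u \<in> H"
  using maps_to by (auto simp: Pi_iff)

lemma T_subadditive:
  "t \<ge> 0 \<Longrightarrow> u \<in> H \<Longrightarrow> v \<in> H \<Longrightarrow> T t (\<lambda>x. u x + v x) x \<le> T t u x + T t v x"
  using sublinear unfolding sublinear_on_def le_fun_def by blast

lemma T_scale: "t \<ge> 0 \<Longrightarrow> u \<in> H \<Longrightarrow> c \<ge> 0 \<Longrightarrow> T t (\<lambda>x. c * u x) x = c * T t u x"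
  using sublinear unfolding sublinear_on_def by metis

lemma T_mono: "t \<ge> 0 \<Longrightarrow> u \<in> H \<Longrightarrow> v \<in> H \<Longrightarrow> (\<And>y. u y \<le> v y) \<Longrightarrow> T t u x \<le> T t v x"
  using monotone by (simp add: le_fun_def)

lemma T_const_le:
  assumes "t \<ge> 0" "c \<ge> 0"
  shows "T t (\<lambda>x. c) x \<le> c"
proof -
  have "T t (\<lambda>x. 1) x \<le> 1"
    using sub_Markov[OF assms(1)] by (simp add: le_fun_def)
  then have "c * T t (\<lambda>x. 1) x \<le> c"
    using assms(2) by (simp add: mult_left_le)
  then show ?thesis
    using T_scale[OF assms(1) const_mem[of 1] assms(2), of x] by simp
qed

text \<open>This packages monotonicity, subadditivity, homogeneity and the sub-Markov bound; the
  signs of \<open>h\<close> and \<open>c\<close> matter, since homogeneity covers nonnegative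
  factors only.\<close>

lemma T_le_add:
  assumes "t \<ge> 0" "u \<in> H" "v \<in> H" "w \<in> H" "h \<ge> 0" "c \<ge> 0"
    and le: "\<And>y. u y \<le> v y + h * w y + c"
  shows "T t u x \<le> T t v x + h * T t w x + c"
proof -
  have "T t u x \<le> T t (\<lambda>y. (v y + h * w y) + c) x"
    using assms by (intro T_mono add_mem scale_mem const_mem) auto
  also have "\<dots> \<le> T t (\<lambda>y. v y + h * w y) x + T t (\<lambda>y. c) x"
    using assms by (intro T_subadditive add_mem scale_mem const_mem)
  also have "\<dots> \<le> (T t v x + T t (\<lambda>y. h * w y) x) + c"
    using assms by (intro add_mono T_subadditive scale_mem T_const_le)
  finally show ?thesis using assms by (simp add: T_scale)
qed

text \<open>
  Here \<open>k\<close> is \<open>Af\<close> for \<open>\<sigma> = 1\<close> and \<open>- Af\<close> for \<open>\<sigma> = -1\<close>; the two signs yield the upper and the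
  lower bound of the theorem.
\<close>

context
  fixes f k :: "real ^ 'n \<Rightarrow> real" and \<sigma> :: real
  assumes f: "f \<in> H" and k: "k \<in> H" and \<sigma>: "\<sigma> \<in> {1, -1}"
    and expansion: "\<And>\<epsilon>. \<epsilon> > 0 \<Longrightarrow>
      \<exists>\<delta>>0. \<forall>h>0. h < \<delta> \<longrightarrow> (\<forall>y. \<bar>\<sigma> * (T h f y - f y) - h * k y\<bar> \<le> h * \<epsilon>)"
begin

text \<open>Writing \<open>T (s + h) f\<close> as \<open>T s (T h f)\<close> puts the short-time
  estimate inside \<open>T s\<close>. A sublinear operator need not commute with negation, so for
  \<open>\<sigma> = -1\<close> the estimate is rearranged to bound \<open>f\<close> by
  \<open>T h f\<close> before \<open>T s\<close> is applied.\<close>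

lemma increment_le:
  assumes "s \<ge> 0" "h > 0" "\<epsilon> > 0"
    and le: "\<And>y. \<sigma> * (T h f y - f y) \<le> h * k y + h * \<epsilon>"
  shows "\<sigma> * T (s + h) f x - \<sigma> * T s f x \<le> h * (T s k x + \<epsilon>)"
proof -
  have Th: "T h f \<in> H" and semi: "T (s + h) f = T s (T h f)"
    using assms f semigroup[of h s f] by (auto intro: T_mem)
  consider "\<sigma> = 1" | "\<sigma> = -1" using \<sigma> by blast
  then show ?thesis
  proof cases
    case 1
    have "T s (T h f) x \<le> T s f x + h * T s k x + h * \<epsilon>"
    proof (rule T_le_add)
      fix y show "T h f y \<le> f y + h * k y + h * \<epsilon>" using le[of y] 1 by simp
    qed (use assms f k Th in auto)
    then show ?thesis using 1 semi by (simp add: algebra_simps)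
  next
    case 2
    have "T s f x \<le> T s (T h f) x + h * T s k x + h * \<epsilon>"
    proof (rule T_le_add)
      fix y show "f y \<le> T h f y + h * k y + h * \<epsilon>" using le[of y] 2 by simp
    qed (use assms f k Th in auto)
    then show ?thesis using 2 semi by (simp add: algebra_simps)
  qed
qed

lemma local_increment_le:
  assumes "\<epsilon> > 0"
  shows "\<exists>\<delta>>0. \<forall>s\<ge>0. \<forall>h>0. h < \<delta> \<longrightarrow>
    \<sigma> * T (s + h) f x - \<sigma> * T s f x \<le> h * (T s k x + \<epsilon>)"
proof -
  obtain \<delta> where \<delta>: "\<delta> > 0"
    "\<And>h y. h > 0 \<Longrightarrow> h < \<delta> \<Longrightarrow> \<bar>\<sigma> * (T h f y - f y) - h * k y\<bar> \<le> h * \<epsilon>"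
    using expansion[OF assms] by blast
  have "\<sigma> * T (s + h) f x - \<sigma> * T s f x \<le> h * (T s k x + \<epsilon>)"
    if "s \<ge> 0" "h > 0" "h < \<delta>" for s h
  proof (rule increment_le)
    fix y show "\<sigma> * (T h f y - f y) \<le> h * k y + h * \<epsilon>"
      using \<delta>(2)[of h y] that by linarith
  qed (use that assms in auto)
  with \<delta>(1) show ?thesis by blast
qed

text \<open>The increment of \<open>\<sigma> * T r f y\<close> over the times \<open>r\<close> from
  \<open>s\<close> to \<open>2 * s\<close> is computed twice: the expansions at \<open>2 * s\<close>
  and \<open>s\<close> give about \<open>s * k y\<close>, while \<open>increment_le\<close> bounds
  it by about \<open>s * T s k y\<close>. Dividing by \<open>s\<close> compares \<open>k\<close>
  with \<open>T s k\<close>.\<close>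

lemma le_T_shortly_after:
  assumes "\<epsilon> > 0"
  shows "\<exists>\<delta>>0. \<forall>s\<ge>0. s < \<delta> \<longrightarrow> (\<forall>y. k y \<le> T s k y + \<epsilon>)"
proof -
  \<comment> \<open>Relative to \<open>s\<close>, the expansion at \<open>2 * s\<close> costs two
    quarters, the one at \<open>s\<close> one, and \<open>increment_le\<close> one.\<close>
  have \<epsilon>: "\<epsilon> / 4 > 0" using assms by simp
  obtain \<delta> where \<delta>: "\<delta> > 0"
    "\<And>h y. h > 0 \<Longrightarrow> h < \<delta> \<Longrightarrow> \<bar>\<sigma> * (T h f y - f y) - h * k y\<bar> \<le> h * (\<epsilon> / 4)"
    using expansion[OF \<epsilon>] by blast
  have "k y \<le> T s k y + \<epsilon>" if s: "s \<ge> 0" "s < \<delta> / 2" for s y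
  proof (cases "s = 0")
    case True
    then show ?thesis using assms k zero by simp
  next
    case False
    with s have "s > 0" by simp
    have "\<sigma> * T (s + s) f y - \<sigma> * T s f y \<le> s * (T s k y + \<epsilon> / 4)"
    proof (rule increment_le)
      fix z show "\<sigma> * (T s f z - f z) \<le> s * k z + s * (\<epsilon> / 4)"
        using \<delta>(2)[of s z] s \<open>s > 0\<close> by linarith
    qed (use \<open>s > 0\<close> \<epsilon> in auto)
    moreover have "\<sigma> * (T (s + s) f y - f y) \<ge> (s + s) * k y - (s + s) * (\<epsilon> / 4)"
      using \<delta>(2)[of "s + s" y] s \<open>s > 0\<close> by linarith
    moreover have "\<sigma> * (T s f y - f y) \<le> s * k y + s * (\<epsilon> / 4)"
      using \<delta>(2)[of s y] s \<open>s > 0\<close> by linarith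
    ultimately have "s * k y \<le> s * (T s k y + \<epsilon>)"
      by (simp add: algebra_simps)
    then show ?thesis using \<open>s > 0\<close> by simp
  qed
  then show ?thesis using \<delta>(1) by (intro exI[of _ "\<delta> / 2"]) auto
qed

lemma small_drops_orbit: "small_drops (\<lambda>s. T s k x)"
  unfolding small_drops_def
proof (intro allI impI)
  fix \<epsilon> :: real assume \<epsilon>: "\<epsilon> > 0"
  obtain \<delta> where \<delta>: "\<delta> > 0" "\<And>s y. s \<ge> 0 \<Longrightarrow> s < \<delta> \<Longrightarrow> k y \<le> T s k y + \<epsilon>"
    using le_T_shortly_after[OF \<epsilon>] by blast
  have "T r k x \<le> T (r + s) k x + \<epsilon>" if "r \<ge> 0" "s \<ge> 0" "s < \<delta>" for r s
  proof -
    \<comment> \<open>Monotonicity of \<open>T r\<close> needs the inequality at all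
      \<open>y\<close> with the same \<open>s\<close>. The zero term only fits the shape of
      \<open>T_le_add\<close>.\<close>
    have "T r k x \<le> T r (T s k) x + 0 * T r k x + \<epsilon>"
      using that k \<epsilon> \<delta>(2) by (intro T_le_add T_mem) auto
    then show ?thesis using semigroup[of s r k] that k by simp
  qed
  with \<delta>(1) show "\<exists>\<delta>>0. \<forall>r\<ge>0. \<forall>s\<ge>0. s < \<delta> \<longrightarrow> T r k x \<le> T (r + s) k x + \<epsilon>" by blast
qed

lemma signed_increment_le_integral:
  assumes "t \<ge> 0"
  shows "\<sigma> * (T t f x - f x) \<le> (LINT s:{0..t}|lborel. T s k x)"
  using increment_le_set_integral[where \<phi> = "\<lambda>s. \<sigma> * T s f x",
      OF small_drops_orbit assms local_increment_le]
    zero[OF f] by (simp add: algebra_simps)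

end

end

section \<open>From the strong generator to the two bounds\<close>

lemma has_strong_generator_uniform:
  assumes "has_strong_generator H T f g" and "\<epsilon> > 0"
  shows "\<exists>\<delta>>0. \<forall>h>0. h < \<delta> \<longrightarrow> (\<forall>y. \<bar>(T h f y - f y) - h * g y\<bar> \<le> h * \<epsilon>)"
proof -
  let ?u = "\<lambda>h y. (T h f y - f y) / h - g y"
  have "((\<lambda>h. sup_norm (?u h)) \<longlongrightarrow> 0) (at_right 0)"
    using assms(1) by (simp add: has_strong_generator_def)
  \<comment> \<open>The extended-valued norm is eventually finite, and one \<open>\<delta>\<close>
    then works for all points at once.\<close>
  then have "\<forall>\<^sub>F h in at_right 0. sup_norm (?u h) < ennreal \<epsilon>"
    using assms(2) by (intro order_tendstoD) auto
  then obtain \<delta> where \<delta>: "\<delta> > 0" "\<And>h. h > 0 \<Longrightarrow> h < \<delta> \<Longrightarrow> sup_norm (?u h) < ennreal \<epsilon>"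
    unfolding eventually_at_right_field by blast
  have "\<bar>(T h f y - f y) - h * g y\<bar> \<le> h * \<epsilon>" if h: "h > 0" "h < \<delta>" for h y
  proof -
    have "ennreal \<bar>?u h y\<bar> \<le> sup_norm (?u h)"
      unfolding sup_norm_def by (intro SUP_upper) simp
    also have "\<dots> < ennreal \<epsilon>" using \<delta> h by blast
    finally have "\<bar>?u h y\<bar> \<le> \<epsilon>"
      using assms(2) by (simp add: ennreal_less_iff)
    then have "h * \<bar>?u h y\<bar> \<le> h * \<epsilon>" using h by simp
    also have "h * \<bar>?u h y\<bar> = \<bar>h * ?u h y\<bar>" using h by (simp add: abs_mult)
    also have "h * ?u h y = (T h f y - f y) - h * g y" using h by (simp add: field_simps)
    finally show ?thesis .
  qed
  with \<delta>(1) show ?thesis by blast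
qed

theorem theorem3p4:
  fixes H :: "(real ^ 'n \<Rightarrow> real) set"
    and T :: "real \<Rightarrow> (real ^ 'n \<Rightarrow> real) \<Rightarrow> (real ^ 'n \<Rightarrow> real)"
    and f :: "real ^ 'n \<Rightarrow> real"
  assumes "sublinear_Markov_semigroup H T"
    and "f \<in> generator_domain H T"
  shows "\<forall>t\<ge>0. \<forall>x.
    set_integrable lborel {0..t} (\<lambda>s. T s (\<lambda>y. - generator H T f y) x) \<and>
    set_integrable lborel {0..t} (\<lambda>s. T s (generator H T f) x) \<and>
    - (LINT s:{0..t}|lborel. T s (\<lambda>y. - generator H T f y) x) \<le> T t f x - f x \<and>
    T t f x - f x \<le> (LINT s:{0..t}|lborel. T s (generator H T f) x)"
proof -
  interpret sublinear_Markov_semigroup H T by fact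
  obtain g where g: "has_strong_generator H T f g"
    using assms(2) unfolding generator_domain_def by blast
  have fH: "f \<in> H" and gH: "g \<in> H" using g by (auto simp: has_strong_generator_def)
  have mgH: "(\<lambda>y. - g y) \<in> H" using scale_mem[OF gH, of "-1"] by simp
  have upper: "\<exists>\<delta>>0. \<forall>h>0. h < \<delta> \<longrightarrow> (\<forall>y. \<bar>1 * (T h f y - f y) - h * g y\<bar> \<le> h * \<epsilon>)"
    if "\<epsilon> > 0" for \<epsilon>
    using has_strong_generator_uniform[OF g that] by simp
  \<comment> \<open>For \<open>\<sigma> = -1\<close> and \<open>k = - g\<close> the remainder only
    changes sign, so the expansion of \<open>f\<close> itself suffices and \<open>T\<close> is never
    applied to \<open>- f\<close>.\<close>
  have lower: "\<exists>\<delta>>0. \<forall>h>0. h < \<delta> \<longrightarrow> (\<forall>y. \<bar>-1 * (T h f y - f y) - h * (- g y)\<bar> \<le> h * \<epsilon>)"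
    if "\<epsilon> > 0" for \<epsilon>
  proof -
    have "\<bar>-1 * (a - b) - h * (- c)\<bar> = \<bar>(a - b) - h * c\<bar>" for a b c h :: real by simp
    then show ?thesis using has_strong_generator_uniform[OF g that] by simp
  qed
  show ?thesis
    unfolding generator_eq[OF g]
  proof (intro allI impI conjI)
    fix t :: real and x assume t: "t \<ge> 0"
    \<comment> \<open>The integral of a nonintegrable function is 0 by convention, so integrability
      is what gives the two inequalities their intended meaning.\<close>
    show "set_integrable lborel {0..t} (\<lambda>s. T s (\<lambda>y. - g y) x)"
      using small_drops_orbit[OF fH mgH _ lower] by (intro small_drops_set_integrable) auto
    show "set_integrable lborel {0..t} (\<lambda>s. T s g x)"
      using small_drops_orbit[OF fH gH _ upper] by (intro small_drops_set_integrable) auto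
    show "- (LINT s:{0..t}|lborel. T s (\<lambda>y. - g y) x) \<le> T t f x - f x"
      using signed_increment_le_integral[OF fH mgH _ lower t, of x] by simp
    show "T t f x - f x \<le> (LINT s:{0..t}|lborel. T s g x)"
      using signed_increment_le_integral[OF fH gH _ upper t, of x] by simp
  qed
qed

end
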